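(* Let $R$ be an abelian $*$-ring. Then $R$ is $*$-regular if and only if $R$ is special $*$-clean.
   Context: Rings are associative with identity. A $*$-ring is a ring $R$ with an involution $*$, i.e. an additive map $*:R\to R$ with $(ab)^*=b^*a^*$ and $(a^* )^*=a$ for all $a,b\in R$. A projection is a self-adjoint idempotent ($p=p^2=p^*$). A ring is abelian if all of its idempotents are central. A $*$-ring $R$ is $*$-regular if it is von Neumann regular (for each $a\in R$ there is $x\in R$ with $a=axa$) and is a Rickart $*$-ring, i.e. the right annihilator of each element is of the form $pR$ for a projection $p$ (equivalently, $R$ is von Neumann regular and $x^*x=0$ implies $x=0$). A $*$-ring $R$ is special $*$-clean if each $a\in R$ can be written as $a=u+p$ with $u$ a unit, $p$ a projection, and $aR\cap pR=0$. *)

theory Defs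
  imports "HOL-Algebra.Ring" "HOL-Algebra.Coset"
begin

locale star_ring = ring R for R (structure) +
  fixes star :: "'a \<Rightarrow> 'a"
  assumes star_closed: "a \<in> carrier R \<Longrightarrow> star a \<in> carrier R"
    and star_add: "\<lbrakk>a \<in> carrier R; b \<in> carrier R\<rbrakk> \<Longrightarrow> star (a \<oplus> b) = star a \<oplus> star b"
    and star_mult: "\<lbrakk>a \<in> carrier R; b \<in> carrier R\<rbrakk> \<Longrightarrow> star (a \<otimes> b) = star b \<otimes> star a"
    and star_star: "a \<in> carrier R \<Longrightarrow> star (star a) = a"

definition idempotents :: "('a, 'm) ring_scheme \<Rightarrow> 'a set" where
  "idempotents R = {e \<in> carrier R. e \<otimes>\<^bsub>R\<^esub> e = e}"

definition projections :: "('a, 'm) ring_scheme \<Rightarrow> ('a \<Rightarrow> 'a) \<Rightarrow> 'a set" where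
  "projections R star = {p \<in> idempotents R. star p = p}"

text \<open>``Abelian'' refers to idempotents and does not mean that multiplication commutes;
  it is unrelated to the library's \<open>abelian_group\<close>.\<close>

definition idempotents_central :: "('a, 'm) ring_scheme \<Rightarrow> bool" where
  "idempotents_central R \<longleftrightarrow>
     (\<forall>e \<in> idempotents R. \<forall>x \<in> carrier R. e \<otimes>\<^bsub>R\<^esub> x = x \<otimes>\<^bsub>R\<^esub> e)"

text \<open>The principal right ideal \<open>aR\<close> is rendered throughout by the library's
  \<open>a <# carrier R\<close>, i.e. the set of all products \<open>a \<otimes> r\<close> with \<open>r\<close> in the carrier.\<close>

definition von_neumann_regular :: "('a, 'm) ring_scheme \<Rightarrow> bool" where
  "von_neumann_regular R \<longleftrightarrow>
     (\<forall>a \<in> carrier R. \<exists>x \<in> carrier R. a = a \<otimes>\<^bsub>R\<^esub> x \<otimes>\<^bsub>R\<^esub> a)"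

definition right_annihilator :: "('a, 'm) ring_scheme \<Rightarrow> 'a \<Rightarrow> 'a set" where
  "right_annihilator R a = {x \<in> carrier R. a \<otimes>\<^bsub>R\<^esub> x = \<zero>\<^bsub>R\<^esub>}"

definition rickart_star :: "('a, 'm) ring_scheme \<Rightarrow> ('a \<Rightarrow> 'a) \<Rightarrow> bool" where
  "rickart_star R star \<longleftrightarrow>
     (\<forall>a \<in> carrier R. \<exists>p \<in> projections R star. right_annihilator R a = p <#\<^bsub>R\<^esub> carrier R)"

definition star_regular :: "('a, 'm) ring_scheme \<Rightarrow> ('a \<Rightarrow> 'a) \<Rightarrow> bool" where
  "star_regular R star \<longleftrightarrow> von_neumann_regular R \<and> rickart_star R star"

definition special_star_clean :: "('a, 'm) ring_scheme \<Rightarrow> ('a \<Rightarrow> 'a) \<Rightarrow> bool" where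
  "special_star_clean R star \<longleftrightarrow>
     (\<forall>a \<in> carrier R. \<exists>u \<in> Units R. \<exists>p \<in> projections R star.
        a = u \<oplus>\<^bsub>R\<^esub> p \<and> (a <#\<^bsub>R\<^esub> carrier R) \<inter> (p <#\<^bsub>R\<^esub> carrier R) = {\<zero>\<^bsub>R\<^esub>})"

end

theory Submission
  imports Defs
begin

text \<open>For a central idempotent \<open>p\<close>, both conditions describe the same picture: \<open>R\<close> splits as
  \<open>(\<one> \<ominus> p)R \<times> pR\<close>, and \<open>a\<close> is a unit of the first factor and zero in the second.

  If \<open>a\<close> is regular, say \<open>a = a \<otimes> x \<otimes> a\<close>, then \<open>a \<otimes> x\<close> and \<open>x \<otimes> a\<close> are central
  idempotents, hence equal, and their common complement generates the right annihilator of \<open>a\<close>. A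
  principal ideal has at most one central idempotent generator, so the projection \<open>p\<close> given by the
  Rickart condition is this complement, and \<open>a \<ominus> p\<close> is a unit: it is invertible in the first
  factor and is \<open>\<ominus>\<one>\<close> in the second. This is \<open>unit_minus_annihilator_generator\<close>.

  Conversely, let \<open>a = u \<oplus> p\<close> with \<open>aR \<inter> pR = 0\<close>. The element \<open>a \<otimes> p = p \<otimes> a\<close> lies in both
  ideals, so it vanishes and \<open>a = u \<otimes> (\<one> \<ominus> p)\<close>. Then \<open>inv u\<close> is a von Neumann inverse of
  \<open>a\<close>, and the right annihilator of \<open>a\<close> is \<open>pR\<close>. Thus the projection that witnesses
  cleanness of \<open>a\<close> is also the one that generates its annihilator.\<close>

context ring
begin

lemma mem_idempotent_coset_iff:
  assumes "p \<in> idempotents R"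
  shows "y \<in> p <# carrier R \<longleftrightarrow> y \<in> carrier R \<and> p \<otimes> y = y"
  using assms unfolding idempotents_def l_coset_def
  by (auto simp: m_assoc[symmetric]) metis

lemma complement_mult_eq_zero_iff:
  assumes "p \<in> carrier R" "y \<in> carrier R"
  shows "(\<one> \<ominus> p) \<otimes> y = \<zero> \<longleftrightarrow> p \<otimes> y = y"
proof -
  have "(\<one> \<ominus> p) \<otimes> y = y \<ominus> p \<otimes> y"
    using assms by (simp add: minus_eq l_distr l_minus)
  moreover have "y = (y \<ominus> p \<otimes> y) \<oplus> p \<otimes> y"
    using assms by (simp add: minus_eq a_assoc l_neg)
  ultimately show ?thesis
    using assms by (auto simp: minus_eq r_neg)
qed

lemma mult_central_idempotent_eq_zero:
  assumes "idempotents_central R" "p \<in> idempotents R" "a \<in> carrier R"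
    and "(a <# carrier R) \<inter> (p <# carrier R) = {\<zero>}"
  shows "a \<otimes> p = \<zero>"
proof -
  have p: "p \<in> carrier R" and comm: "a \<otimes> p = p \<otimes> a"
    using assms unfolding idempotents_def idempotents_central_def by auto
  have "a \<otimes> p \<in> a <# carrier R"
    using p unfolding l_coset_def by auto
  moreover have "a \<otimes> p \<in> p <# carrier R"
    using assms(3) comm unfolding l_coset_def by auto
  ultimately show "a \<otimes> p = \<zero>" using assms(4) by blast
qed

lemma ideals_inter_zero_if_mult_zero:
  assumes "p \<in> idempotents R" "a \<in> carrier R" "p \<otimes> a = \<zero>"
  shows "(a <# carrier R) \<inter> (p <# carrier R) = {\<zero>}"
proof
  show "(a <# carrier R) \<inter> (p <# carrier R) \<subseteq> {\<zero>}"
  proof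
    fix y assume y: "y \<in> (a <# carrier R) \<inter> (p <# carrier R)"
    then obtain r where r: "r \<in> carrier R" "y = a \<otimes> r"
      unfolding l_coset_def by auto
    have "y = p \<otimes> y" using y mem_idempotent_coset_iff[OF assms(1)] by auto
    also have "\<dots> = (p \<otimes> a) \<otimes> r"
      using r assms(1,2) by (simp add: m_assoc idempotents_def)
    finally show "y \<in> {\<zero>}" using assms(3) r by simp
  qed
  have "p \<in> carrier R" using assms(1) by (simp add: idempotents_def)
  then show "{\<zero>} \<subseteq> (a <# carrier R) \<inter> (p <# carrier R)"
    using assms(2) r_null[symmetric] unfolding l_coset_def by blast
qed

text \<open>Write \<open>e = a \<otimes> x\<close> and \<open>f = x \<otimes> a\<close>. Moving \<open>f\<close> past \<open>x\<close> in \<open>e = (a \<otimes> f) \<otimes> x\<close> gives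
  \<open>e = e \<otimes> f\<close>, and moving \<open>e\<close> past \<open>x\<close> in \<open>f = x \<otimes> (e \<otimes> a)\<close> gives \<open>f = e \<otimes> f\<close>.\<close>

lemma von_neumann_inverse_commutes:
  assumes central: "idempotents_central R"
    and a: "a \<in> carrier R" and x: "x \<in> carrier R" and axa: "a = a \<otimes> x \<otimes> a"
  shows "x \<otimes> a \<in> idempotents R" "a \<otimes> x = x \<otimes> a"
proof -
  have "(a \<otimes> x) \<otimes> (a \<otimes> x) = (a \<otimes> x \<otimes> a) \<otimes> x" using a x by (simp add: m_assoc)
  then have e: "a \<otimes> x \<in> idempotents R" using a x axa by (simp add: idempotents_def)
  have "(x \<otimes> a) \<otimes> (x \<otimes> a) = x \<otimes> (a \<otimes> x \<otimes> a)" using a x by (simp add: m_assoc)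
  then show f: "x \<otimes> a \<in> idempotents R" using a x axa by (simp add: idempotents_def)
  have "a \<otimes> x = (a \<otimes> x \<otimes> a) \<otimes> x" using axa by simp
  also have "\<dots> = a \<otimes> ((x \<otimes> a) \<otimes> x)" using a x by (simp add: m_assoc)
  also have "(x \<otimes> a) \<otimes> x = x \<otimes> (x \<otimes> a)"
    using central f x unfolding idempotents_central_def by blast
  also have "a \<otimes> (x \<otimes> (x \<otimes> a)) = (a \<otimes> x) \<otimes> (x \<otimes> a)" using a x by (simp add: m_assoc)
  finally have ef: "a \<otimes> x = (a \<otimes> x) \<otimes> (x \<otimes> a)" .
  have "x \<otimes> a = x \<otimes> ((a \<otimes> x) \<otimes> a)" using axa by simp
  also have "\<dots> = (x \<otimes> (a \<otimes> x)) \<otimes> a" using a x by (simp add: m_assoc)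
  also have "x \<otimes> (a \<otimes> x) = (a \<otimes> x) \<otimes> x"
    using central e x unfolding idempotents_central_def by auto
  also have "((a \<otimes> x) \<otimes> x) \<otimes> a = (a \<otimes> x) \<otimes> (x \<otimes> a)" using a x by (simp add: m_assoc)
  finally show "a \<otimes> x = x \<otimes> a" using ef by simp
qed

text \<open>The idempotents \<open>p\<close> and \<open>\<one> \<ominus> x \<otimes> a\<close> generate the same ideal, namely the right
  annihilator of \<open>a\<close>, and central idempotents are determined by the ideals they generate.\<close>

lemma annihilator_generator_eq_complement:
  assumes central: "idempotents_central R"
    and a: "a \<in> carrier R" and x: "x \<in> carrier R" and axa: "a = a \<otimes> x \<otimes> a"
    and p: "p \<in> idempotents R" and ann: "right_annihilator R a = p <# carrier R"
  shows "a \<otimes> p = \<zero>" "\<one> = x \<otimes> a \<oplus> p"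
proof -
  define f where "f = x \<otimes> a"
  have f: "f \<in> carrier R" using a x by (simp add: f_def)
  have pc: "p \<in> carrier R" and pp: "p \<otimes> p = p" using p by (auto simp: idempotents_def)
  have "p \<in> p <# carrier R" using mem_idempotent_coset_iff[OF p] pc pp by simp
  then show ap: "a \<otimes> p = \<zero>" using ann by (auto simp: right_annihilator_def)
  have af: "a \<otimes> f = a" using axa a x by (simp add: f_def m_assoc)
  have "a \<otimes> (\<one> \<ominus> f) = a \<ominus> a \<otimes> f" using a f by (simp add: minus_eq r_distr r_minus)
  then have "a \<otimes> (\<one> \<ominus> f) = \<zero>" using af a by (simp add: r_neg minus_eq)
  then have "\<one> \<ominus> f \<in> p <# carrier R"
    using f ann by (auto simp: right_annihilator_def)
  then have "\<one> \<ominus> f = p \<otimes> (\<one> \<ominus> f)" using mem_idempotent_coset_iff[OF p] by simp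
  also have "\<dots> = p \<ominus> p \<otimes> f" using f pc by (simp add: minus_eq r_distr r_minus)
  also have "p \<otimes> f = f \<otimes> p"
    using central p f unfolding idempotents_central_def by blast
  also have "f \<otimes> p = \<zero>" using ap a x pc by (simp add: f_def m_assoc)
  finally have "\<one> \<ominus> f = p" using pc by (simp add: minus_eq)
  moreover have "\<one> = (\<one> \<ominus> f) \<oplus> f"
    using f by (simp add: minus_eq a_assoc l_neg)
  ultimately show "\<one> = x \<otimes> a \<oplus> p" using f pc a_comm by (simp add: f_def)
qed

text \<open>The inverse is assembled factor by factor: with \<open>f = x \<otimes> a = \<one> \<ominus> p\<close>, the element \<open>a\<close> has
  inverse \<open>f \<otimes> x\<close> in \<open>fR\<close>, while \<open>\<ominus>p\<close> is its own inverse in \<open>pR\<close>. Hence \<open>f \<otimes> x \<ominus> p\<close>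
  inverts \<open>a \<ominus> p\<close>.\<close>

lemma unit_minus_annihilator_generator:
  assumes central: "idempotents_central R"
    and a: "a \<in> carrier R" and x: "x \<in> carrier R" and axa: "a = a \<otimes> x \<otimes> a"
    and p: "p \<in> idempotents R" and ann: "right_annihilator R a = p <# carrier R"
  shows "a \<ominus> p \<in> Units R"
proof -
  define f where "f = x \<otimes> a"
  define y where "y = f \<otimes> x"
  have pc: "p \<in> carrier R" and pp: "p \<otimes> p = p" using p by (auto simp: idempotents_def)
  have fc: "f \<in> carrier R" and yc: "y \<in> carrier R" using a x by (simp_all add: f_def y_def)
  note commute = von_neumann_inverse_commutes[OF central a x axa]
  have ff: "f \<otimes> f = f" and ax: "a \<otimes> x = f"
    using commute by (auto simp: f_def idempotents_def)
  note generator = annihilator_generator_eq_complement[OF central a x axa p ann]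
  have ap: "a \<otimes> p = \<zero>" by (rule generator)
  have one: "f \<oplus> p = \<one>" using generator by (simp add: f_def)
  have p_central: "p \<otimes> z = z \<otimes> p" if "z \<in> carrier R" for z
    using central p that unfolding idempotents_central_def by blast
  have pa: "p \<otimes> a = \<zero>" using p_central a ap by simp
  have fp: "f \<otimes> p = \<zero>" using ap a x pc by (simp add: f_def m_assoc)
  have pf: "p \<otimes> f = \<zero>" using p_central fc fp by simp
  have py: "p \<otimes> y = \<zero>"
    using pf pc fc x by (simp add: y_def m_assoc[symmetric])
  have yp: "y \<otimes> p = \<zero>" using p_central yc py by simp
  have "a \<otimes> y = (a \<otimes> f) \<otimes> x" using a fc x by (simp add: y_def m_assoc)
  also have "a \<otimes> f = a" using axa a x by (simp add: f_def m_assoc)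
  finally have ay: "a \<otimes> y = f" using ax by simp
  have ya: "y \<otimes> a = f" using ff a fc x by (simp add: y_def m_assoc) (simp add: f_def)
  have prod: "(b \<ominus> p) \<otimes> (c \<ominus> p) = \<one>"
    if "b \<in> carrier R" "c \<in> carrier R" "b \<otimes> c = f" "b \<otimes> p = \<zero>" "p \<otimes> c = \<zero>" for b c
    using that pc fc pp one
    by (simp add: minus_eq l_distr r_distr l_minus r_minus)
  show ?thesis
    unfolding Units_def
    using prod[OF a yc ay ap py] prod[OF yc a ya yp pa] a yc pc by blast
qed

text \<open>Right multiplication by \<open>\<one> \<ominus> p\<close> leaves \<open>a\<close> unchanged because \<open>a \<otimes> p = \<zero>\<close>, and it
  kills the summand \<open>p\<close> of \<open>u \<oplus> p\<close>.\<close>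

lemma special_clean_factorization:
  assumes "u \<in> carrier R" "p \<in> idempotents R" "a = u \<oplus> p" "a \<otimes> p = \<zero>"
  shows "a = u \<otimes> (\<one> \<ominus> p)"
proof -
  have pc: "p \<in> carrier R" and pp: "p \<otimes> p = p" using assms by (auto simp: idempotents_def)
  have "u \<otimes> p \<oplus> p = \<zero>" using assms pc pp by (simp add: l_distr)
  then have "p = \<ominus> (u \<otimes> p)"
    using assms(1) pc by (metis add.m_comm m_closed minus_equality minus_minus)
  then show ?thesis using assms(1,3) pc by (simp add: minus_eq r_distr r_minus)
qed

lemma unit_times_complement_regular:
  assumes "u \<in> Units R" "p \<in> idempotents R"
    and a: "a = u \<otimes> (\<one> \<ominus> p)" and ap: "a \<otimes> p = \<zero>"
  shows "a = a \<otimes> inv u \<otimes> a"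
proof -
  have pc: "p \<in> carrier R" and uc: "u \<in> carrier R" and ac: "a \<in> carrier R"
    using assms by (auto simp: idempotents_def)
  have "inv u \<otimes> a = (inv u \<otimes> u) \<otimes> (\<one> \<ominus> p)"
    using uc pc assms(1) by (subst a) (rule m_assoc[symmetric], auto)
  then have "inv u \<otimes> a = \<one> \<ominus> p" using assms(1) pc by simp
  then have "a \<otimes> inv u \<otimes> a = a \<otimes> (\<one> \<ominus> p)"
    using ac assms(1) by (simp add: m_assoc)
  also have "\<dots> = a" using ac pc ap by (simp add: minus_eq r_distr r_minus)
  finally show ?thesis by simp
qed

lemma right_annihilator_unit_times_complement:
  assumes u: "u \<in> Units R" and p: "p \<in> idempotents R"
  shows "right_annihilator R (u \<otimes> (\<one> \<ominus> p)) = p <# carrier R"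
proof -
  have pc: "p \<in> carrier R" and uc: "u \<in> carrier R"
    using assms by (auto simp: idempotents_def)
  have "u \<otimes> (\<one> \<ominus> p) \<otimes> y = \<zero> \<longleftrightarrow> p \<otimes> y = y" if y: "y \<in> carrier R" for y
  proof -
    have "u \<otimes> (\<one> \<ominus> p) \<otimes> y = \<zero> \<longleftrightarrow> u \<otimes> ((\<one> \<ominus> p) \<otimes> y) = u \<otimes> \<zero>"
      using uc pc y by (simp add: m_assoc)
    also have "\<dots> \<longleftrightarrow> (\<one> \<ominus> p) \<otimes> y = \<zero>"
      using u pc y by (intro Units_l_cancel) auto
    finally show ?thesis using complement_mult_eq_zero_iff[OF pc y] by simp
  qed
  then show ?thesis
    unfolding right_annihilator_def using mem_idempotent_coset_iff[OF p] by auto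
qed

lemma special_star_clean_if_star_regular:
  assumes central: "idempotents_central R" and reg: "star_regular R star"
  shows "special_star_clean R star"
  unfolding special_star_clean_def
proof
  fix a assume a: "a \<in> carrier R"
  obtain x where x: "x \<in> carrier R" "a = a \<otimes> x \<otimes> a"
    using reg a unfolding star_regular_def von_neumann_regular_def by blast
  obtain p where proj: "p \<in> projections R star"
    and ann: "right_annihilator R a = p <# carrier R"
    using reg a unfolding star_regular_def rickart_star_def by blast
  have p: "p \<in> idempotents R" and pc: "p \<in> carrier R"
    using proj by (auto simp: projections_def idempotents_def)
  have "a \<otimes> p = \<zero>" by (rule annihilator_generator_eq_complement[OF central a x p ann])
  then have "p \<otimes> a = \<zero>" using central p a by (auto simp: idempotents_central_def)
  then have "(a <# carrier R) \<inter> (p <# carrier R) = {\<zero>}"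
    by (rule ideals_inter_zero_if_mult_zero[OF p a])
  moreover have "a = (a \<ominus> p) \<oplus> p" using a pc by (simp add: minus_eq a_assoc l_neg)
  ultimately show "\<exists>u\<in>Units R. \<exists>p\<in>projections R star.
      a = u \<oplus> p \<and> (a <# carrier R) \<inter> (p <# carrier R) = {\<zero>}"
    using unit_minus_annihilator_generator[OF central a x p ann] proj by blast
qed

lemma star_regular_if_special_star_clean:
  assumes central: "idempotents_central R" and clean: "special_star_clean R star"
  shows "star_regular R star"
proof -
  have "\<exists>x\<in>carrier R. a = a \<otimes> x \<otimes> a"
    and "\<exists>p\<in>projections R star. right_annihilator R a = p <# carrier R"
    if a: "a \<in> carrier R" for a
  proof -
    obtain u p where u: "u \<in> Units R" and proj: "p \<in> projections R star"
      and sum: "a = u \<oplus> p" and inter: "(a <# carrier R) \<inter> (p <# carrier R) = {\<zero>}"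
      using clean a unfolding special_star_clean_def by blast
    have p: "p \<in> idempotents R" using proj by (simp add: projections_def)
    have ap: "a \<otimes> p = \<zero>" by (rule mult_central_idempotent_eq_zero[OF central p a inter])
    have fact: "a = u \<otimes> (\<one> \<ominus> p)"
      by (rule special_clean_factorization[OF Units_closed[OF u] p sum ap])
    show "\<exists>x\<in>carrier R. a = a \<otimes> x \<otimes> a"
      using unit_times_complement_regular[OF u p fact ap] u by blast
    show "\<exists>p\<in>projections R star. right_annihilator R a = p <# carrier R"
      using right_annihilator_unit_times_complement[OF u p] fact proj by auto
  qed
  then show ?thesis
    unfolding star_regular_def von_neumann_regular_def rickart_star_def by blast
qed

end

theorem theorem5p3:
  fixes R :: "('a, 'm) ring_scheme" and star :: "'a \<Rightarrow> 'a"
  assumes "star_ring R star"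
    and "idempotents_central R"
  shows "star_regular R star \<longleftrightarrow> special_star_clean R star"
proof -
  interpret star_ring R star by (rule assms(1))
  show ?thesis
    using special_star_clean_if_star_regular star_regular_if_special_star_clean assms(2)
    by blast
qed

end
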